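(* Let $X_N=\{\mathbf{x}_1,\dots,\mathbf{x}_N\}\subseteq\mathbb{S}^2$, $\mathbf{w}\in\mathbb{R}^N$, and let $Q[X_N,\mathbf{w}]$ be the associated quadrature. Let $n\in\mathbb{N}_0$, and for $f\in C(\mathbb{S}^2)$ let $p^*\in\operatorname{argmin}_{p\in\mathbb{P}_n(\mathbb{S}^2)}\|f-p\|_\infty$ be a best uniform approximation polynomial of $f$ in $\mathbb{P}_n(\mathbb{S}^2)$. If $Q[X_N,\mathbf{w}]$ satisfies an $L^2$ Marcinkiewicz–Zygmund (MZ) condition of degree $n$ with constant $c\ge0$, then the hyperinterpolation operator $L_n$ associated with $Q[X_N,\mathbf{w}]$ is stable in the sense that $$\|L_n\|_{C\to L^2}\le c\sqrt{4\pi},$$ and, for any $f\in C(\mathbb{S}^2)$, the hyperinterpolation error satisfies $$\|L_nf-f\|_{L^2}\le(c+1)\sqrt{4\pi}\,\|f-p^*\|_\infty+\|L_np^*-p^*\|_{L^2}.$$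
   Context: $\mathbb{S}^2$ is the unit sphere in $\mathbb{R}^3$ with surface measure $\omega$ of total mass $4\pi$; $C(\mathbb{S}^2)$ is the space of real continuous functions with sup norm $\|\cdot\|_\infty$; $\|\cdot\|_{L^2}$ is the $L^2(\mathbb{S}^2,\omega)$ norm; $I(f)=\int_{\mathbb{S}^2}f\,d\omega$. $\mathbb{P}_n(\mathbb{S}^2)$ is the space of spherical polynomials of degree at most $n$ (restrictions to $\mathbb{S}^2$ of real polynomials on $\mathbb{R}^3$ of degree $\le n$). The quadrature is $Q[X_N,\mathbf{w}](f):=\sum_{j=1}^Nw_jf(\mathbf{x}_j)$; the weights may have any sign, and no exactness is assumed. Write $|\mathbf{w}|:=(|w_1|,\dots,|w_N|)$. The quadrature satisfies an $L^2$ MZ condition of degree $n$ with constant $c\ge0$ if $Q[X_N,|\mathbf{w}|](f^2)\le c\,I(f^2)$ for all $f\in\mathbb{P}_n(\mathbb{S}^2)$. The hyperinterpolation operator $L_n:C(\mathbb{S}^2)\to\mathbb{P}_n(\mathbb{S}^2)$ is $L_nf(\mathbf{x}):=\sum_{j=1}^Nw_jf(\mathbf{x}_j)G_n(\mathbf{x},\mathbf{x}_j)$, where $G_n(\mathbf{x},\mathbf{y}):=\sum_{\ell=0}^n\frac{2\ell+1}{4\pi}P_\ell(\langle\mathbf{x},\mathbf{y}\rangle)$ is the reproducing kernel of $\mathbb{P}_n(\mathbb{S}^2)$ with the $L^2$ inner product and $P_\ell$ is the Legendre polynomial of degree $\ell$ with $P_\ell(1)=1$. $\|L_n\|_{C\to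 L^2}$ is the operator norm from $(C(\mathbb{S}^2),\|\cdot\|_\infty)$ to $L^2(\mathbb{S}^2)$. *)

theory Defs
  imports "HOL-Analysis.Analysis" "HOL-Computational_Algebra.Polynomial"
begin

section \<open>The sphere and its surface measure\<close>

abbreviation S2 :: "(real^3) set" where
  "S2 \<equiv> sphere 0 1"

text \<open>
  The surface measure of a Borel set \<open>A\<close> of the unit sphere in dimension \<open>d\<close> is \<open>d\<close> times the volume
  of the cone \<open>{t *\<^sub>R x | 0 < t < 1, x \<in> A}\<close> over it, that is, of the set of those \<open>y\<close> in the
  punctured unit ball with \<open>y / norm y = sgn y \<in> A\<close>.  This is the radial part of Lebesgue measure
  (\<open>dy = r\<^sup>2 dr d\<omega>\<close> for \<open>d = 3\<close>); the total mass and the invariance under rotations are proved below.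
\<close>

definition surface_measure :: "(real^3) measure" where
  "surface_measure =
     scale_measure 3 (distr (restrict_space lborel (ball 0 1 - {0})) (restrict_space borel S2) sgn)"

text \<open>
  Functions on the sphere are functions on the ambient space of which only the values on \<open>S2\<close> matter.
\<close>

definition sphere_integral :: "(real^3 \<Rightarrow> real) \<Rightarrow> real" where
  "sphere_integral f = (\<integral>y. f y \<partial>surface_measure)"

definition L2_norm_S2 :: "(real^3 \<Rightarrow> real) \<Rightarrow> real" where
  "L2_norm_S2 f = sqrt (sphere_integral (\<lambda>y. (f y)\<^sup>2))"

definition C_S2 :: "(real^3 \<Rightarrow> real) set" where
  "C_S2 = {f. continuous_on S2 f}"

definition sup_norm_S2 :: "(real^3 \<Rightarrow> real) \<Rightarrow> real" where
  "sup_norm_S2 f = (SUP y\<in>S2. \<bar>f y\<bar>)"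

text \<open>The supremum is taken in \<open>ereal\<close>, so it is \<open>\<infinity>\<close> for an unbounded operator.\<close>

definition opnorm_C_L2 :: "((real^3 \<Rightarrow> real) \<Rightarrow> (real^3 \<Rightarrow> real)) \<Rightarrow> ereal" where
  "opnorm_C_L2 T = (SUP f\<in>{f \<in> C_S2. sup_norm_S2 f \<le> 1}. ereal (L2_norm_S2 (T f)))"


section \<open>Spherical polynomials and the reproducing kernel\<close>

definition multi_indices :: "nat \<Rightarrow> (3 \<Rightarrow> nat) set" where
  "multi_indices n = {\<alpha>. (\<Sum>i\<in>UNIV. \<alpha> i) \<le> n}"

definition spherical_polys :: "nat \<Rightarrow> (real^3 \<Rightarrow> real) set" where
  "spherical_polys n =
     {p. \<exists>a. \<forall>y\<in>S2. p y = (\<Sum>\<alpha>\<in>multi_indices n. a \<alpha> * (\<Prod>i\<in>UNIV. (y $ i) ^ \<alpha> i))}"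

text \<open>Rodrigues' formula.\<close>

definition legendre :: "nat \<Rightarrow> real poly" where
  "legendre l = smult (1 / (2 ^ l * fact l)) ((pderiv ^^ l) ([:-1, 0, 1:] ^ l))"

definition G_kernel :: "nat \<Rightarrow> real^3 \<Rightarrow> real^3 \<Rightarrow> real" where
  "G_kernel n x y = (\<Sum>l=0..n. (2 * real l + 1) / (4 * pi) * poly (legendre l) (x \<bullet> y))"


section \<open>Quadrature and hyperinterpolation\<close>

definition quadrature :: "('N::finite \<Rightarrow> real^3) \<Rightarrow> real^'N \<Rightarrow> (real^3 \<Rightarrow> real) \<Rightarrow> real" where
  "quadrature x w f = (\<Sum>j\<in>UNIV. w $ j * f (x j))"

definition abs_weights :: "real^'N::finite \<Rightarrow> real^'N" where
  "abs_weights w = (\<chi> j. \<bar>w $ j\<bar>)"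

definition L2_MZ :: "('N::finite \<Rightarrow> real^3) \<Rightarrow> real^'N \<Rightarrow> nat \<Rightarrow> real \<Rightarrow> bool" where
  "L2_MZ x w n c \<longleftrightarrow>
     (\<forall>f\<in>spherical_polys n.
        quadrature x (abs_weights w) (\<lambda>y. (f y)\<^sup>2) \<le> c * sphere_integral (\<lambda>y. (f y)\<^sup>2))"

definition hyperinterpolation ::
    "('N::finite \<Rightarrow> real^3) \<Rightarrow> real^'N \<Rightarrow> nat \<Rightarrow> (real^3 \<Rightarrow> real) \<Rightarrow> real^3 \<Rightarrow> real" where
  "hyperinterpolation x w n f y = (\<Sum>j\<in>UNIV. w $ j * f (x j) * G_kernel n y (x j))"

definition best_uniform_approx :: "nat \<Rightarrow> (real^3 \<Rightarrow> real) \<Rightarrow> (real^3 \<Rightarrow> real) \<Rightarrow> bool" where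
  "best_uniform_approx n f p \<longleftrightarrow>
     is_arg_min (\<lambda>q. sup_norm_S2 (\<lambda>y. f y - q y)) (\<lambda>q. q \<in> spherical_polys n) p"


section \<open>Consistency of the definitions\<close>

lemma finite_multi_indices: "finite (multi_indices n)"
proof (rule finite_subset)
  show "multi_indices n \<subseteq> PiE UNIV (\<lambda>_. {..n})"
    unfolding multi_indices_def
    by (auto simp: PiE_def) (meson UNIV_I finite member_le_sum order_trans zero_le)
  show "finite (PiE (UNIV :: 3 set) (\<lambda>_. {..n}))"
    by (rule finite_PiE) auto
qed

lemma poly_higher_pderiv_shift:
  fixes q :: "real poly"
  shows "poly ((pderiv ^^ k) ([:-1, 1:] ^ k * q)) 1 = fact k * poly q 1"
proof (induction k arbitrary: q)
  case (Suc k)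
  have "pderiv ([:-1, 1:] ^ Suc k * q)
      = [:-1, 1:] ^ k * (smult (of_nat (Suc k)) q + [:-1, 1:] * pderiv q)"
    by (simp only: pderiv_mult pderiv_power_Suc) (simp add: pderiv_pCons algebra_simps)
  then show ?case
    by (simp only: funpow_Suc_right o_apply Suc.IH) (simp add: algebra_simps)
qed simp

lemma poly_legendre_1: "poly (legendre l) 1 = 1"
proof -
  have "[:-1, 0, 1:] ^ l = [:-1, 1:] ^ l * ([:1, 1:] :: real poly) ^ l"
    by (simp flip: power_mult_distrib)
  then show ?thesis
    by (simp only: legendre_def poly_smult poly_higher_pderiv_shift) simp
qed

lemma sgn_in_S2: "y \<noteq> 0 \<Longrightarrow> sgn y \<in> S2" for y :: "real^3"
  by (simp add: norm_sgn)

lemma sgn_measurable_S2 [measurable]: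
  "sgn \<in> restrict_space lborel (ball 0 1 - {0}) \<rightarrow>\<^sub>M restrict_space borel S2"
  by (rule measurable_restrict_space3)
     (auto simp: norm_sgn sgn_div_norm intro: borel_measurable_sgn)

lemma space_surface_measure [simp]: "space surface_measure = S2"
  by (simp add: surface_measure_def space_scale_measure space_restrict_space)

lemma sets_surface_measure [simp, measurable_cong]:
  "sets surface_measure = sets (restrict_space borel S2)"
  by (simp add: surface_measure_def)

lemma emeasure_surface_measure:
  assumes "A \<in> sets borel" "A \<subseteq> S2"
  shows "emeasure surface_measure A = 3 * emeasure lborel {y \<in> ball 0 1 - {0}. sgn y \<in> A}"
proof -
  have A: "A \<in> sets (restrict_space borel S2)"
    using assms by (auto simp: sets_restrict_space)
  have "sgn -` A \<inter> space (restrict_space lborel (ball 0 1 - {0})) = {y \<in> ball 0 1 - {0}. sgn y \<in> A}"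
    by (auto simp: space_restrict_space)
  then have "emeasure (distr (restrict_space lborel (ball 0 1 - {0})) (restrict_space borel S2) sgn) A
      = emeasure lborel {y \<in> ball 0 1 - {0}. sgn y \<in> A}"
    by (subst emeasure_distr[OF sgn_measurable_S2 A]) (subst emeasure_restrict_space; auto)
  then show ?thesis
    by (simp add: surface_measure_def)
qed

lemma emeasure_surface_measure_S2: "emeasure surface_measure S2 = ennreal (4 * pi)"
proof -
  have "{y \<in> ball 0 1 - {0}. sgn y \<in> S2} = ball 0 1 - {0 :: real^3}"
    using sgn_in_S2 by blast
  moreover have "emeasure lborel (ball 0 1 - {0 :: real^3}) = ennreal (4 / 3 * pi)"
    by (subst emeasure_Diff) (auto simp: emeasure_ball unit_ball_vol_3)
  ultimately show ?thesis
    by (subst emeasure_surface_measure) (auto simp flip: ennreal_numeral ennreal_mult')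
qed

lemma surface_measure_orthogonal_invariant:
  assumes T: "orthogonal_transformation (T :: real^3 \<Rightarrow> real^3)" and A: "A \<in> sets borel" "A \<subseteq> S2"
  shows "emeasure surface_measure (T ` A) = emeasure surface_measure A"
proof -
  define cone where "cone = (\<lambda>B. {y \<in> ball 0 1 - {0 :: real^3}. sgn y \<in> B})"
  have lin: "linear T" and nrm: "norm (T y) = norm y" and inj: "inj T" and surj: "surj T" for y
    using T by (auto simp: orthogonal_transformation_linear orthogonal_transformation_norm
        orthogonal_transformation_inj orthogonal_transformation_surj)
  have inv: "orthogonal_transformation (inv T)"
    using T by (rule orthogonal_transformation_inv)
  have sgnT: "sgn (T y) = T (sgn y)" for y
    by (simp add: sgn_div_norm nrm linear_cmul[OF lin])
  have TA: "T ` A \<in> sets borel" "T ` A \<subseteq> S2"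
  proof -
    have "T ` A = inv T -` A \<inter> space borel"
      using inj surj by (auto simp: bij_vimage_eq_inv_image bij_def bij_image_Collect_eq inv_f_f
          surj_f_inv_f image_iff intro!: bexI[where x="inv T _"])
    moreover have "inv T \<in> borel_measurable borel"
      by (intro borel_measurable_continuous_onI linear_continuous_on linear_conv_bounded_linear[THEN iffD1]
          orthogonal_transformation_linear inv)
    ultimately show "T ` A \<in> sets borel"
      using A(1) measurable_sets by metis
    show "T ` A \<subseteq> S2" using A(2) nrm by auto
  qed
  have cone_sets: "cone B \<in> sets borel" if "B \<in> sets borel" for B
  proof -
    have "cone B = (ball 0 1 - {0}) \<inter> (sgn -` B \<inter> space borel)"
      by (auto simp: cone_def)
    moreover have "sgn -` B \<inter> space (borel :: (real^3) measure) \<in> sets borel"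
      using borel_measurable_sgn that by (rule measurable_sets)
    ultimately show ?thesis by auto
  qed
  have cone_image: "cone (T ` A) = T ` cone A"
  proof
    show "T ` cone A \<subseteq> cone (T ` A)"
      using nrm by (auto simp: cone_def sgnT) (metis nrm norm_eq_zero)
    show "cone (T ` A) \<subseteq> T ` cone A"
    proof
      fix z assume z: "z \<in> cone (T ` A)"
      obtain y where y: "z = T y" using surj by auto
      have "T (sgn y) \<in> T ` A" using z by (simp add: cone_def y sgnT)
      then have "sgn y \<in> A" using inj by (simp add: inj_image_mem_iff)
      moreover have "y \<noteq> 0" "norm y < 1"
        using z nrm[of y] by (auto simp: cone_def y)
      ultimately show "z \<in> T ` cone A"
        by (auto simp: cone_def y)
    qed
  qed
  have lm: "cone B \<in> lmeasurable" if "B \<in> sets borel" for B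
  proof (rule bounded_set_imp_lmeasurable)
    show "bounded (cone B)"
      by (rule bounded_subset[OF bounded_ball[of 0 1]]) (auto simp: cone_def)
    show "cone B \<in> sets lebesgue"
      using cone_sets[OF that] by simp
  qed
  have eq: "emeasure lborel (cone B) = ennreal (measure lebesgue (cone B))" if "B \<in> sets borel" for B
    using emeasure_eq_measure2[OF lm[OF that]] cone_sets[OF that]
    by simp
  have "emeasure lborel (cone (T ` A)) = emeasure lborel (cone A)"
    using measure_orthogonal_image[OF T lm[OF A(1)]] eq[OF A(1)] eq[OF TA(1)] by (simp add: cone_image)
  then show ?thesis
    by (simp add: emeasure_surface_measure A TA cone_def)
qed

end

theory Submission
  imports Defs
begin

text \<open>
  Everything rests on the identity that the integral of \<open>r(y \<bullet> b) G\<^sub>n(y, a)\<close> over the sphere is \<open>r(a \<bullet> b)\<close>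
  for polynomials \<open>r\<close> of degree at most \<open>n\<close>.  Rotations around \<open>a\<close> reduce it to a statement about
  zonal functions \<open>q(y \<bullet> a)\<close>, whose integral is \<open>2\<pi>\<close> times the integral of \<open>q\<close> over \<open>[-1, 1]\<close>, so that
  the Legendre expansion of \<open>q\<close> applies.  No spherical coordinates are needed: the invariance of the
  measure gives recursions for the moments, by comparing coefficients of polynomials in a parameter.

  Pairing \<open>L\<^sub>n f\<close> with itself and using the identity, \<open>\<parallel>L\<^sub>n f\<parallel>\<^sup>2 = Q(f \<cdot> L\<^sub>n f)\<close>, which the Cauchy-Schwarz
  inequality and the MZ condition for \<open>1\<close> and for \<open>L\<^sub>n f\<close> bound by \<open>c \<surd>(4\<pi>) \<parallel>f\<parallel>\<^sub>\<infinity> \<parallel>L\<^sub>n f\<parallel>\<close>.  The error bound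
  follows from \<open>L\<^sub>n f - f = L\<^sub>n (f - p) + (L\<^sub>n p - p) - (f - p)\<close>.
\<close>

section \<open>Integration of continuous functions over the sphere\<close>

lemma finite_measure_surface_measure: "finite_measure surface_measure"
  by (rule finite_measureI) (simp add: emeasure_surface_measure_S2)

lemma measurable_continuous_S2:
  "continuous_on S2 f \<Longrightarrow> f \<in> borel_measurable surface_measure" for f :: "real^3 \<Rightarrow> real"
  by (simp add: borel_measurable_continuous_on_restrict cong: measurable_cong_sets)

lemma integrable_continuous_S2:
  fixes f :: "real^3 \<Rightarrow> real"
  assumes "continuous_on S2 f"
  shows "integrable surface_measure f"
proof -
  interpret finite_measure surface_measure
    by (rule finite_measure_surface_measure)
  have "bounded (f ` S2)"
    using assms by (intro compact_imp_bounded compact_continuous_image) auto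
  then obtain B where "\<forall>y\<in>S2. norm (f y) \<le> B"
    unfolding bounded_iff by blast
  then show ?thesis
    using measurable_continuous_S2[OF assms] by (intro integrable_const_bound[of f B] AE_I2) auto
qed

lemma sphere_integral_cong:
  "(\<And>y. y \<in> S2 \<Longrightarrow> f y = g y) \<Longrightarrow> sphere_integral f = sphere_integral g"
  unfolding sphere_integral_def by (rule Bochner_Integration.integral_cong) auto

lemma sphere_integral_const: "sphere_integral (\<lambda>_. k) = 4 * pi * k"
  by (simp add: sphere_integral_def measure_def emeasure_surface_measure_S2)

lemma sphere_integral_add:
  "continuous_on S2 f \<Longrightarrow> continuous_on S2 g \<Longrightarrow>
    sphere_integral (\<lambda>y. f y + g y) = sphere_integral f + sphere_integral g"
  by (simp add: sphere_integral_def integrable_continuous_S2)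

lemma sphere_integral_cmult: "sphere_integral (\<lambda>y. k * f y) = k * sphere_integral f"
  by (simp add: sphere_integral_def)

lemma sphere_integral_sum:
  "(\<And>i. i \<in> I \<Longrightarrow> continuous_on S2 (f i)) \<Longrightarrow>
    sphere_integral (\<lambda>y. \<Sum>i\<in>I. f i y) = (\<Sum>i\<in>I. sphere_integral (f i))"
  by (simp add: sphere_integral_def integrable_continuous_S2)

lemma sphere_integral_mono:
  "continuous_on S2 f \<Longrightarrow> continuous_on S2 g \<Longrightarrow> (\<And>y. y \<in> S2 \<Longrightarrow> f y \<le> g y) \<Longrightarrow>
    sphere_integral f \<le> sphere_integral g"
  unfolding sphere_integral_def by (intro integral_mono integrable_continuous_S2) auto

lemma sphere_integral_nonneg: "(\<And>y. y \<in> S2 \<Longrightarrow> 0 \<le> f y) \<Longrightarrow> 0 \<le> sphere_integral f"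
  unfolding sphere_integral_def by (rule Bochner_Integration.integral_nonneg) auto

text \<open>The image of the surface measure under \<open>T\<close> is the measure itself:
  \<open>T\<close> maps the preimage \<open>B\<close> of \<open>A\<close> onto \<open>A\<close>, and
  \<open>T\<close> preserves the measure of Borel sets. The rest is the change of variables
  formula.\<close>

lemma sphere_integral_orthogonal_transformation:
  fixes f :: "real^3 \<Rightarrow> real"
  assumes T: "orthogonal_transformation T" and f: "continuous_on S2 f"
  shows "sphere_integral (\<lambda>y. f (T y)) = sphere_integral f"
proof -
  have nrm: "norm (T y) = norm y" for y
    using T by (rule orthogonal_transformation_norm)
  have "continuous_on UNIV T"
    using T by (simp add: linear_continuous_on linear_linear orthogonal_transformation_linear)
  then have Tmeas: "T \<in> borel_measurable borel"
    by (rule borel_measurable_continuous_onI)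
  have T1: "T \<in> restrict_space borel S2 \<rightarrow>\<^sub>M restrict_space borel S2"
    by (rule measurable_restrict_space3) (auto simp: nrm Tmeas)
  then have T2: "T \<in> surface_measure \<rightarrow>\<^sub>M surface_measure"
    by (simp cong: measurable_cong_sets)
  have "distr surface_measure surface_measure T = surface_measure"
  proof (rule measure_eqI)
    fix A assume "A \<in> sets (distr surface_measure surface_measure T)"
    then have A: "A \<in> sets surface_measure" by simp
    define B where "B = T -` A \<inter> S2"
    have "B \<in> sets (restrict_space borel S2)"
      using measurable_sets[OF T2 A] by (simp add: B_def)
    then have B: "B \<in> sets borel" "B \<subseteq> S2"
      by (auto simp: B_def sets_restrict_space)
    have "A \<subseteq> S2"
      using sets.sets_into_space[OF A] by simp
    then have "B = T -` A"
      using nrm by (auto simp: B_def)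
    then have "T ` B = A"
      using orthogonal_transformation_surj[OF T] by (simp add: surj_image_vimage_eq)
    then show "emeasure (distr surface_measure surface_measure T) A = emeasure surface_measure A"
      using surface_measure_orthogonal_invariant[OF T B] by (simp add: emeasure_distr[OF T2 A] flip: B_def)
  qed simp
  then have "sphere_integral f = (\<integral>y. f y \<partial>distr surface_measure surface_measure T)"
    by (simp add: sphere_integral_def)
  also have "\<dots> = sphere_integral (\<lambda>y. f (T y))"
    unfolding sphere_integral_def
    by (rule integral_distr[OF T2 measurable_continuous_S2[OF f]])
  finally show ?thesis by simp
qed

text \<open>The witness is the Householder reflection in the hyperplane orthogonal to
  \<open>u - v\<close>; it is symmetric and involutive, hence orthogonal. For \<open>u = v\<close>
  it degenerates to the identity. Symmetry lets \<open>T\<close> pass from the integration variable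
  to the fixed vectors.\<close>

lemma reflection_exists:
  fixes u v :: "'a::euclidean_space"
  assumes "norm u = norm v"
  obtains T where "orthogonal_transformation T" "T u = v" "\<And>y z. T y \<bullet> z = y \<bullet> T z"
    "\<And>a. a \<bullet> u = a \<bullet> v \<Longrightarrow> T a = a"
proof
  define d where "d = u - v"
  define T where "T = (\<lambda>y. y - (2 * (y \<bullet> d) / (d \<bullet> d)) *\<^sub>R d)"
  show sym: "T y \<bullet> z = y \<bullet> T z" for y z
    by (simp add: T_def algebra_simps inner_commute)
  have invol: "T (T y) = y" for y
  proof (cases "d = 0")
    case False
    then have "T y \<bullet> d = - (y \<bullet> d)"
      by (simp add: T_def inner_diff_left)
    then show ?thesis
      by (subst (1) T_def) (simp add: T_def)
  qed (simp add: T_def)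
  have "linear T"
    unfolding T_def by (rule linearI) (auto simp: algebra_simps add_divide_distrib)
  then show "orthogonal_transformation T"
    by (simp add: orthogonal_transformation_def sym invol)
  have uv: "u \<bullet> u = v \<bullet> v"
    using assms by (simp add: dot_square_norm)
  show "T u = v"
  proof (cases "d = 0")
    case False
    moreover have "2 * (u \<bullet> d) = d \<bullet> d"
      by (simp add: d_def algebra_simps inner_commute uv)
    ultimately show ?thesis
      by (simp add: T_def) (simp add: d_def)
  qed (simp add: T_def d_def)
  show "T a = a" if "a \<bullet> u = a \<bullet> v" for a
    using that by (simp add: T_def d_def algebra_simps)
qed

text \<open>The reflection exchanging \<open>u\<close> and \<open>v\<close> fixes \<open>a\<close>,
  so substituting \<open>T y\<close> for \<open>y\<close> replaces \<open>y \<bullet> u\<close> by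
  \<open>y \<bullet> v\<close> and keeps \<open>y \<bullet> a\<close>. The choice
  \<open>a = 0\<close> imposes no axis.\<close>

lemma sphere_integral_inner_invariant:
  fixes u v a :: "real^3" and F :: "real \<Rightarrow> real \<Rightarrow> real"
  assumes "norm u = norm v" "a \<bullet> u = a \<bullet> v" "continuous_on S2 (\<lambda>y. F (y \<bullet> u) (y \<bullet> a))"
  shows "sphere_integral (\<lambda>y. F (y \<bullet> v) (y \<bullet> a)) = sphere_integral (\<lambda>y. F (y \<bullet> u) (y \<bullet> a))"
proof -
  obtain T where T: "orthogonal_transformation T" "T u = v" "\<And>y z. T y \<bullet> z = y \<bullet> T z"
    "\<And>a. a \<bullet> u = a \<bullet> v \<Longrightarrow> T a = a"
    using reflection_exists[OF assms(1)] by metis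
  show ?thesis
    using sphere_integral_orthogonal_transformation[OF T(1) assms(3)] by (simp add: T assms)
qed

text \<open>Up to the factor \<open>k + 1\<close>, both sides are the coefficient of \<open>\<beta>\<^sup>2\<close> in the integral of
  \<open>(y \<bullet> (u + \<beta> v)) ^ (2k+2) h(y \<bullet> a)\<close>, which by invariance is \<open>(1 + \<beta>\<^sup>2) ^ (k+1)\<close> times its value
  at \<open>\<beta> = 0\<close>.\<close>

lemma sphere_integral_even_power:
  fixes u v a :: "real^3" and h :: "real \<Rightarrow> real"
  assumes "norm u = 1" "norm v = 1" "u \<bullet> v = 0" "a \<bullet> u = 0" "a \<bullet> v = 0" and h: "continuous_on UNIV h"
  shows "(2 * real k + 1) * sphere_integral (\<lambda>y. (y \<bullet> u) ^ (2*k) * (y \<bullet> v)\<^sup>2 * h (y \<bullet> a))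
       = sphere_integral (\<lambda>y. (y \<bullet> u) ^ (2*k+2) * h (y \<bullet> a))"
proof -
  define N where "N = 2 * k + 2"
  define C where "C = sphere_integral (\<lambda>y. (y \<bullet> u) ^ N * h (y \<bullet> a))"
  define c where "c j = sphere_integral (\<lambda>y. (y \<bullet> u) ^ (N - j) * (y \<bullet> v) ^ j * h (y \<bullet> a))" for j
  define p where "p = (\<Sum>j\<le>N. monom (real (N choose j) * c j) j)"
  have [continuous_intros]: "continuous_on S2 (\<lambda>y. h (y \<bullet> a))"
    by (rule continuous_on_compose2[OF h]) (auto intro!: continuous_intros)
  have "poly p \<beta> = poly (smult C ([:1, 0, 1:] ^ (k+1))) \<beta>" for \<beta>
  proof -
    \<comment> \<open>By orthonormality \<open>u + \<beta> *\<^sub>R v\<close> has length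
      \<open>sqrt (1 + \<beta>\<^sup>2)\<close>. Both vectors are orthogonal to \<open>a\<close>, so
      one may replace the other in the integral.\<close>
    have norm_eq: "norm (sqrt (1 + \<beta>\<^sup>2) *\<^sub>R u) = norm (u + \<beta> *\<^sub>R v)"
      using assms by (simp add: norm_eq_sqrt_inner algebra_simps inner_commute power2_eq_square)
    have "sphere_integral (\<lambda>y. (y \<bullet> (u + \<beta> *\<^sub>R v)) ^ N * h (y \<bullet> a))
        = sphere_integral (\<lambda>y. (y \<bullet> (sqrt (1 + \<beta>\<^sup>2) *\<^sub>R u)) ^ N * h (y \<bullet> a))"
      by (rule sphere_integral_inner_invariant[OF norm_eq])
         (auto simp: assms inner_add_right intro!: continuous_intros)
    also have "\<dots> = sphere_integral (\<lambda>y. (1 + \<beta>\<^sup>2) ^ (k+1) * ((y \<bullet> u) ^ N * h (y \<bullet> a)))"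
    proof -
      have "sqrt (1 + \<beta>\<^sup>2) ^ N = ((sqrt (1 + \<beta>\<^sup>2))\<^sup>2) ^ (k + 1)"
        unfolding N_def power_mult [symmetric] by simp
      also have "\<dots> = (1 + \<beta>\<^sup>2) ^ (k + 1)"
        by (subst real_sqrt_pow2) auto
      finally show ?thesis
        by (simp add: power_mult_distrib mult.assoc)
    qed
    also have "\<dots> = (1 + \<beta>\<^sup>2) ^ (k+1) * C"
      by (simp only: sphere_integral_cmult C_def)
    finally have "sphere_integral (\<lambda>y. (y \<bullet> (u + \<beta> *\<^sub>R v)) ^ N * h (y \<bullet> a)) = (1 + \<beta>\<^sup>2) ^ (k+1) * C" .
    moreover have "sphere_integral (\<lambda>y. (y \<bullet> (u + \<beta> *\<^sub>R v)) ^ N * h (y \<bullet> a))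
        = sphere_integral (\<lambda>y. \<Sum>j\<le>N. real (N choose j) * \<beta> ^ j * ((y \<bullet> u) ^ (N - j) * (y \<bullet> v) ^ j * h (y \<bullet> a)))"
    proof (rule sphere_integral_cong)
      fix y :: "real^3"
      have "y \<bullet> (u + \<beta> *\<^sub>R v) = \<beta> * (y \<bullet> v) + y \<bullet> u"
        by (simp add: inner_add_right)
      then show "(y \<bullet> (u + \<beta> *\<^sub>R v)) ^ N * h (y \<bullet> a)
        = (\<Sum>j\<le>N. real (N choose j) * \<beta> ^ j * ((y \<bullet> u) ^ (N - j) * (y \<bullet> v) ^ j * h (y \<bullet> a)))"
        by (simp add: binomial_ring sum_distrib_left sum_distrib_right power_mult_distrib mult_ac)
    qed
    moreover have "\<dots> = (\<Sum>j\<le>N. real (N choose j) * \<beta> ^ j * c j)"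
      by (subst sphere_integral_sum) (auto intro!: continuous_intros simp: sphere_integral_cmult c_def)
    ultimately have "poly p \<beta> = (1 + \<beta>\<^sup>2) ^ (k+1) * C"
      by (simp add: p_def poly_sum poly_monom mult_ac)
    moreover have "poly [:1, 0, 1:] \<beta> = 1 + \<beta>\<^sup>2"
      by (simp add: power2_eq_square)
    ultimately show ?thesis
      by (simp only: poly_smult poly_power mult.commute)
  qed
  then have "p = smult C ([:1, 0, 1:] ^ (k+1))"
    by (simp flip: poly_eq_poly_eq_iff add: fun_eq_iff)
  moreover have "coeff p 2 = real (N choose 2) * c 2"
  proof -
    have "2 \<le> N" by (simp add: N_def)
    then show ?thesis by (simp add: p_def coeff_sum)
  qed
  \<comment> \<open>The constant coefficient is carried along because the induction step for the
    coefficient of degree 2 uses it.\<close>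
  moreover have "coeff ([:1, 0, 1:] ^ m) 2 = real m \<and> coeff ([:1, 0, 1:] ^ m) 0 = (1::real)" for m
    by (induction m) (auto simp: coeff_mult numeral_2_eq_2 coeff_1)
  ultimately have "real (N choose 2) * c 2 = (real k + 1) * C"
    by (metis coeff_smult mult.commute of_nat_Suc Suc_eq_plus1 add.commute)
  moreover have "real (N choose 2) = (real k + 1) * (2 * real k + 1)"
  proof -
    have "N choose 2 = (k + 1) * (2 * k + 1)"
      by (simp add: N_def choose_two)
    then show ?thesis by (simp only: of_nat_mult of_nat_add) simp
  qed
  ultimately have "(real k + 1) * ((2 * real k + 1) * c 2) = (real k + 1) * C"
    by (simp add: mult.assoc)
  then show ?thesis
    by (simp add: c_def C_def N_def)
qed

section \<open>Zonal integrals and Legendre polynomials\<close>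

text \<open>An orthogonal map taking the first basis vector to \<open>a\<close> takes the other two
  to \<open>u\<close> and \<open>v\<close>. Parseval's identity is transported from the standard
  basis.\<close>

lemma orthonormal_frame:
  fixes a :: "real^3"
  assumes "norm a = 1"
  obtains u v where "norm u = 1" "norm v = 1" "u \<bullet> v = 0" "a \<bullet> u = 0" "a \<bullet> v = 0"
    "\<And>y. (y \<bullet> a)\<^sup>2 + (y \<bullet> u)\<^sup>2 + (y \<bullet> v)\<^sup>2 = y \<bullet> y"
proof -
  define e :: "3 \<Rightarrow> real^3" where "e i = axis i 1" for i
  obtain T where T: "orthogonal_transformation T" "T (e 1) = a"
    using orthogonal_transformation_exists_1[of "e 1" a] assms by (auto simp: e_def)
  have dot: "T y \<bullet> T z = y \<bullet> z" for y z
    using T(1) by (simp add: orthogonal_transformation_def)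
  show ?thesis
  proof
    have e_dot: "e i \<bullet> e j = (if i = j then 1 else 0)" for i j
      by (simp add: e_def inner_axis_axis)
    show "norm (T (e 2)) = 1" "norm (T (e 3)) = 1"
      using dot by (simp_all add: norm_eq_sqrt_inner e_dot)
    show "T (e 2) \<bullet> T (e 3) = 0" "a \<bullet> T (e 2) = 0" "a \<bullet> T (e 3) = 0"
      using dot by (simp_all add: e_dot flip: T(2))
    show "(y \<bullet> a)\<^sup>2 + (y \<bullet> T (e 2))\<^sup>2 + (y \<bullet> T (e 3))\<^sup>2 = y \<bullet> y" for y
    proof -
      obtain z where z: "y = T z"
        using orthogonal_transformation_surj[OF T(1)] by (auto simp: surj_def)
      show ?thesis
        unfolding z T(2) [symmetric] dot
        by (simp add: e_def inner_axis inner_vec_def [of z z] sum_3 power2_eq_square)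
    qed
  qed
qed

text \<open>Odd moments vanish by the reflection of \<open>a\<close> to \<open>-a\<close>. For even
  ones, multiply the integrand by \<open>(y \<bullet> a)\<^sup>2 + (y \<bullet> u)\<^sup>2 + (y
  \<bullet> v)\<^sup>2 = 1\<close>: the last two terms are known multiples of the next moment, so
  \<open>(2j+1) m (2j) = (2j+3) m (2j+2)\<close>, starting from the total mass.\<close>

lemma sphere_integral_power_inner:
  fixes a :: "real^3"
  assumes "norm a = 1"
  shows "real (Suc k) * sphere_integral (\<lambda>y. (y \<bullet> a) ^ k) = 2 * pi * (1 - (-1) ^ Suc k)"
proof (cases "even k")
  case True
  obtain u v where uv: "norm u = 1" "norm v = 1" "u \<bullet> v = 0" "a \<bullet> u = 0" "a \<bullet> v = 0"
    "\<And>y. (y \<bullet> a)\<^sup>2 + (y \<bullet> u)\<^sup>2 + (y \<bullet> v)\<^sup>2 = y \<bullet> y"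
    using orthonormal_frame[OF assms] by metis
  define m where "m k = sphere_integral (\<lambda>y. (y \<bullet> a) ^ k)" for k
  \<comment> \<open>Here \<open>a\<close> is the first vector of the orthonormal pair, the axis is 0
    and the weight \<open>h\<close> is 1.\<close>
  have mult: "(2 * real j + 1) * sphere_integral (\<lambda>y. (y \<bullet> a) ^ (2*j) * (y \<bullet> b)\<^sup>2) = m (2*j+2)"
    if "b = u \<or> b = v" for j b
    using sphere_integral_even_power[of a b 0 "\<lambda>_. 1" j] that uv assms by (auto simp: m_def)
  have "(2 * real j + 1) * m (2*j) = 4 * pi" for j
  proof (induction j)
    case 0
    then show ?case by (simp add: m_def sphere_integral_const)
  next
    case (Suc j)
    have "m (2*j) = sphere_integral (\<lambda>y. (y \<bullet> a) ^ (2*j+2) + (y \<bullet> a) ^ (2*j) * (y \<bullet> u)\<^sup>2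
        + (y \<bullet> a) ^ (2*j) * (y \<bullet> v)\<^sup>2)"
      unfolding m_def
    proof (rule sphere_integral_cong)
      fix y :: "real^3" assume "y \<in> S2"
      then have "(y \<bullet> a)\<^sup>2 + (y \<bullet> u)\<^sup>2 + (y \<bullet> v)\<^sup>2 = 1"
        by (simp add: uv dot_square_norm)
      then have "(y \<bullet> a) ^ (2*j) = (y \<bullet> a) ^ (2*j) * ((y \<bullet> a)\<^sup>2 + (y \<bullet> u)\<^sup>2 + (y \<bullet> v)\<^sup>2)"
        by simp
      then show "(y \<bullet> a) ^ (2*j) = (y \<bullet> a) ^ (2*j+2) + (y \<bullet> a) ^ (2*j) * (y \<bullet> u)\<^sup>2
        + (y \<bullet> a) ^ (2*j) * (y \<bullet> v)\<^sup>2"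
        by (simp add: algebra_simps power_add power2_eq_square)
    qed
    also have "\<dots> = m (2*j+2) + sphere_integral (\<lambda>y. (y \<bullet> a) ^ (2*j) * (y \<bullet> u)\<^sup>2)
        + sphere_integral (\<lambda>y. (y \<bullet> a) ^ (2*j) * (y \<bullet> v)\<^sup>2)"
      unfolding m_def by (subst sphere_integral_add; (subst sphere_integral_add)?;
          (auto intro!: continuous_intros)?)
    finally have "(2 * real j + 1) * m (2*j) = (2 * real j + 1) * m (2*j+2)
       + (2 * real j + 1) * sphere_integral (\<lambda>y. (y \<bullet> a) ^ (2*j) * (y \<bullet> u)\<^sup>2)
       + (2 * real j + 1) * sphere_integral (\<lambda>y. (y \<bullet> a) ^ (2*j) * (y \<bullet> v)\<^sup>2)"
      by (simp only: distrib_left)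
    with Suc.IH mult[of u j] mult[of v j] show ?case
      by (simp add: algebra_simps)
  qed
  from this[of "k div 2"] True show ?thesis
    by (auto simp: m_def add.commute elim!: evenE)
next
  case False
  have "sphere_integral (\<lambda>y. (y \<bullet> (-a)) ^ k) = sphere_integral (\<lambda>y. (y \<bullet> a) ^ k)"
    by (rule sphere_integral_inner_invariant[of a "-a" 0 "\<lambda>s _. s ^ k"])
       (auto intro!: continuous_intros)
  moreover have "sphere_integral (\<lambda>y. (y \<bullet> (-a)) ^ k) = - sphere_integral (\<lambda>y. (y \<bullet> a) ^ k)"
    using False sphere_integral_cmult[of "-1" "\<lambda>y. (y \<bullet> a) ^ k"] by simp
  ultimately show ?thesis
    using False by simp
qed

definition zonal_integral :: "real^3 \<Rightarrow> real poly \<Rightarrow> real" where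
  "zonal_integral a q = sphere_integral (\<lambda>y. poly q (y \<bullet> a))"

lemma zonal_integral_add: "zonal_integral a (p + q) = zonal_integral a p + zonal_integral a q"
  unfolding zonal_integral_def poly_add by (rule sphere_integral_add; intro continuous_intros)

lemma zonal_integral_smult: "zonal_integral a (smult k q) = k * zonal_integral a q"
  by (simp add: zonal_integral_def sphere_integral_cmult)

lemma zonal_integral_sum: "zonal_integral a (\<Sum>i\<in>I. q i) = (\<Sum>i\<in>I. zonal_integral a (q i))"
  unfolding zonal_integral_def poly_sum by (rule sphere_integral_sum) (intro continuous_intros)

lemma zonal_integral_0 [simp]: "zonal_integral a 0 = 0"
  using zonal_integral_smult[of a 0 0] by simp

text \<open>This is the fundamental theorem of calculus for the functional
  \<open>q \<mapsto> 2\<pi>\<close> times the integral of \<open>q\<close> over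
  \<open>[-1, 1]\<close>. By linearity it reduces to monomials, that is, to the moments. Stating it
  for derivatives makes integration by parts a product rule.\<close>

lemma zonal_integral_pderiv:
  assumes "norm a = 1"
  shows "zonal_integral a (pderiv q) = 2 * pi * (poly q 1 - poly q (-1))"
proof -
  have mono: "zonal_integral a (pderiv (monom k i)) = 2 * pi * (poly (monom k i) 1 - poly (monom k i) (-1))"
    for k :: real and i
  proof (cases i)
    case (Suc j)
    have "zonal_integral a (pderiv (monom k i))
        = sphere_integral (\<lambda>y. (k * real (Suc j)) * (y \<bullet> a) ^ j)"
      unfolding zonal_integral_def by (simp add: Suc pderiv_monom poly_monom mult_ac)
    also have "\<dots> = k * (real (Suc j) * sphere_integral (\<lambda>y. (y \<bullet> a) ^ j))"
      by (simp only: sphere_integral_cmult mult.assoc)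
    also have "\<dots> = 2 * pi * (poly (monom k i) 1 - poly (monom k i) (-1))"
      unfolding sphere_integral_power_inner[OF assms] by (simp add: Suc poly_monom algebra_simps)
    finally show ?thesis .
  qed (simp add: pderiv_monom poly_monom)
  have "zonal_integral a (pderiv q)
      = (\<Sum>i\<le>degree q. zonal_integral a (pderiv (monom (coeff q i) i)))"
    by (subst poly_as_sum_of_monoms [of q, symmetric])
       (simp only: higher_pderiv_sum[of 1, simplified] zonal_integral_sum)
  also have "\<dots> = 2 * pi * (poly (\<Sum>i\<le>degree q. monom (coeff q i) i) 1
      - poly (\<Sum>i\<le>degree q. monom (coeff q i) i) (-1))"
    by (simp only: mono poly_sum sum_distrib_left [symmetric] sum_subtractf [symmetric])
  finally show ?thesis
    by (simp only: poly_as_sum_of_monoms)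
qed

section \<open>Integration by parts, orthogonality and norms of the Legendre polynomials\<close>

lemma zonal_integral_by_parts:
  assumes "norm a = 1" "poly g 1 = 0" "poly g (-1) = 0"
  shows "zonal_integral a (f * pderiv g) = - zonal_integral a (pderiv f * g)"
proof -
  have "pderiv (f * g) = f * pderiv g + pderiv f * g"
    by (simp add: pderiv_mult mult.commute)
  then show ?thesis
    using zonal_integral_pderiv[OF assms(1), of "f * g"] assms by (simp add: zonal_integral_add)
qed

lemma power_dvd_pderiv: "r ^ Suc m dvd q \<Longrightarrow> r ^ m dvd pderiv q" for r :: "'a::idom poly"
proof (erule dvdE)
  fix k assume "q = r ^ Suc m * k"
  then have "pderiv q = r ^ Suc m * pderiv k + k * (smult (of_nat (Suc m)) (r ^ m) * pderiv r)"
    by (simp only: pderiv_mult pderiv_power_Suc)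
  moreover have "r ^ m dvd r ^ Suc m * pderiv k"
    by (intro dvd_mult2 le_imp_power_dvd) simp
  moreover have "r ^ m dvd k * (smult (of_nat (Suc m)) (r ^ m) * pderiv r)"
    by (intro dvd_mult dvd_mult2 dvd_smult dvd_refl)
  ultimately show "r ^ m dvd pderiv q"
    by (simp only: dvd_add)
qed

text \<open>Each derivative costs at most one factor \<open>r\<close>. For
  \<open>r = [:-1, 0, 1:]\<close> this makes the boundary terms at 1 and -1 vanish when Rodrigues'
  formula is integrated by parts.\<close>

lemma power_dvd_higher_pderiv:
  "j \<le> l \<Longrightarrow> r ^ (l - j) dvd (pderiv ^^ j) (r ^ l)" for r :: "'a::idom poly"
proof (induction j)
  case (Suc j)
  then have "r ^ Suc (l - Suc j) dvd (pderiv ^^ j) (r ^ l)"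
    by (simp add: Suc_diff_Suc)
  then show ?case
    by (simp add: power_dvd_pderiv del: power_Suc)
qed simp

lemma higher_pderiv_eq_0:
  fixes q :: "real poly"
  assumes "\<And>i. i \<ge> l \<Longrightarrow> coeff q i = 0"
  shows "(pderiv ^^ l) q = 0"
  using assms by (intro poly_eqI) (simp add: coeff_higher_pderiv)

text \<open>Integrating by parts \<open>l\<close> times moves all derivatives of Rodrigues' formula
  onto \<open>q\<close>, whose \<open>l\<close>-th derivative is 0. The hypothesis on coefficients
  means degree less than \<open>l\<close> and also makes sense for \<open>l = 0\<close>, where it
  forces \<open>q = 0\<close>.\<close>

lemma zonal_integral_legendre_orthogonal:
  assumes a: "norm a = 1" and q: "\<And>i. i \<ge> l \<Longrightarrow> coeff q i = 0"
  shows "zonal_integral a (q * legendre l) = 0"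
proof -
  define W :: "real poly" where "W = [:-1, 0, 1:] ^ l"
  have "j \<le> l \<Longrightarrow> zonal_integral a (q * (pderiv ^^ l) W)
      = (-1) ^ j * zonal_integral a ((pderiv ^^ j) q * (pderiv ^^ (l - j)) W)" for j
  proof (induction j)
    case (Suc j)
    define g where "g = (pderiv ^^ (l - Suc j)) W"
    \<comment> \<open>At least one factor \<open>[:-1, 0, 1:]\<close> is left in \<open>g\<close>,
      so \<open>g\<close> vanishes at both endpoints.\<close>
    have "[:-1, 0, 1:] ^ Suc j dvd g"
      using power_dvd_higher_pderiv[of "l - Suc j" l "[:-1, 0, 1::real:]"] Suc.prems
      by (simp add: g_def W_def)
    then have "poly g 1 = 0" "poly g (-1) = 0"
      by (auto elim!: dvdE)
    moreover have "(pderiv ^^ (l - j)) W = pderiv g"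
    proof -
      have "l - j = Suc (l - Suc j)" using Suc.prems by simp
      then show ?thesis by (simp add: g_def)
    qed
    ultimately show ?case
      using Suc zonal_integral_by_parts[OF a, of g "(pderiv ^^ j) q"] by (simp add: g_def)
  qed simp
  from this[of l] show ?thesis
    by (simp add: legendre_def W_def zonal_integral_smult higher_pderiv_eq_0 q)
qed

lemma degree_legendre: "degree (legendre l) = l"
  by (simp add: legendre_def degree_higher_pderiv degree_power_eq)

lemma coeff_legendre_nz: "coeff (legendre l) l \<noteq> 0"
proof -
  have "legendre l \<noteq> 0"
    using poly_legendre_1[of l] by auto
  then show ?thesis
    using degree_legendre[of l] leading_coeff_neq_0 by metis
qed

text \<open>Integrate the derivative of \<open>(1 + t) P\<^sub>l\<^sup>2\<close>, using that \<open>(1 + t) P\<^sub>l' - l P\<^sub>l\<close> has degree less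
  than \<open>l\<close>.\<close>

lemma zonal_integral_legendre_square:
  assumes a: "norm a = 1"
  shows "(2 * real l + 1) * zonal_integral a (legendre l * legendre l) = 4 * pi"
proof -
  define P where "P = legendre l"
  define X :: "real poly" where "X = [:1, 1:]"
  define R where "R = X * pderiv P - smult (real l) P"
  have R: "coeff R i = 0" if "i \<ge> l" for i
  proof -
    have "coeff P (Suc i) = 0"
      using that degree_legendre[of l] by (simp add: P_def coeff_eq_0)
    moreover have "i = l \<or> coeff P i = 0"
      using that degree_legendre[of l] by (metis P_def coeff_eq_0 le_neq_implies_less)
    ultimately show ?thesis
      by (cases i) (auto simp: R_def X_def coeff_pderiv coeff_pCons algebra_simps)
  qed
  have X: "pderiv X = 1"
    by (simp add: X_def pderiv_pCons)
  have "pderiv (X * (P * P)) = P * P + (P * (X * pderiv P) + P * (X * pderiv P))"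
    by (simp add: pderiv_mult X algebra_simps)
  also have "X * pderiv P = smult (real l) P + R"
    by (simp add: R_def)
  finally have "pderiv (X * (P * P)) = P * P + (smult (real l) (P * P) + R * P + (smult (real l) (P * P) + R * P))"
    by (simp add: algebra_simps)
  moreover have "zonal_integral a (R * P) = 0"
    unfolding P_def by (rule zonal_integral_legendre_orthogonal[OF a R])
  ultimately have "zonal_integral a (pderiv (X * (P * P)))
      = zonal_integral a (P * P) + 2 * (real l * zonal_integral a (P * P))"
    by (simp only: zonal_integral_add zonal_integral_smult)
  \<comment> \<open>At 1 the factor \<open>X\<close> is 2 and at -1 it is 0, so the integral of the
    derivative is \<open>4\<pi>\<close>, by \<open>P\<^sub>l(1) = 1\<close>.\<close>
  then show ?thesis
    by (simp add: zonal_integral_pderiv[OF a] X_def P_def poly_legendre_1 algebra_simps)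
qed

section \<open>The kernel as a polynomial in the inner product\<close>

definition kernel_poly :: "nat \<Rightarrow> real poly" where
  "kernel_poly n = (\<Sum>l=0..n. smult ((2 * real l + 1) / (4 * pi)) (legendre l))"

lemma G_kernel_eq_kernel_poly: "G_kernel n x y = poly (kernel_poly n) (x \<bullet> y)"
  by (simp add: G_kernel_def kernel_poly_def poly_sum)

lemma degree_kernel_poly: "degree (kernel_poly n) \<le> n"
  unfolding kernel_poly_def
  by (intro degree_sum_le) (auto intro: order_trans[OF degree_smult_le] simp: degree_legendre)

text \<open>Split off the multiple of the Legendre polynomial that cancels the top coefficient of
  \<open>q\<close>. Orthogonality removes the mixed terms, and the weight \<open>\<kappa> m\<close>
  normalises the square to 1, so the split-off part contributes \<open>k\<close>, which is its value
  at 1.\<close>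

lemma zonal_integral_kernel_poly:
  assumes a: "norm a = 1" and "degree q \<le> n"
  shows "zonal_integral a (q * kernel_poly n) = poly q 1"
proof -
  define \<kappa> where "\<kappa> l = (2 * real l + 1) / (4 * pi)" for l
  define S where "S m = (\<Sum>l<m. smult (\<kappa> l) (legendre l))" for m
  \<comment> \<open>The bound \<open>m\<close> is strict, so the induction starts with
    \<open>q = 0\<close> and an empty sum; degree at most \<open>n\<close> corresponds to
    \<open>S (Suc n)\<close>.\<close>
  have "zonal_integral a (q * S m) = poly q 1" if "\<And>i. i \<ge> m \<Longrightarrow> coeff q i = 0" for m q
    using that
  proof (induction m arbitrary: q)
    case 0
    then have "q = 0" by (intro poly_eqI) simp
    then show ?case by simp
  next
    case (Suc m)
    define k where "k = coeff q m / coeff (legendre m) m"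
    define r where "r = q - smult k (legendre m)"
    have r: "coeff r i = 0" if "i \<ge> m" for i
      using that Suc.prems[of i] coeff_legendre_nz[of m] degree_legendre[of m]
      by (cases "i = m") (auto simp: r_def k_def coeff_eq_0)
    have "zonal_integral a (legendre m * S m) = (\<Sum>l<m. \<kappa> l * zonal_integral a (legendre l * legendre m))"
      by (simp add: S_def sum_distrib_left zonal_integral_sum zonal_integral_smult mult.commute)
    also have "\<dots> = 0"
      by (intro sum.neutral ballI) (simp add: zonal_integral_legendre_orthogonal[OF a] coeff_eq_0 degree_legendre)
    finally have 1: "zonal_integral a (legendre m * S m) = 0" .
    have 2: "\<kappa> m * zonal_integral a (legendre m * legendre m) = 1"
      using zonal_integral_legendre_square[OF a, of m] by (simp add: \<kappa>_def field_simps)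
    have "q * S (Suc m) = smult k (legendre m * S m) + r * S m
        + smult k (smult (\<kappa> m) (legendre m * legendre m)) + smult (\<kappa> m) (r * legendre m)"
    proof -
      have "q = smult k (legendre m) + r" by (simp add: r_def)
      then show ?thesis by (simp add: S_def algebra_simps smult_add_right)
    qed
    then have "zonal_integral a (q * S (Suc m)) = poly r 1 + k"
      using Suc.IH[OF r] zonal_integral_legendre_orthogonal[OF a r]
      by (simp add: zonal_integral_add zonal_integral_smult 1 2)
    then show ?case
      by (simp add: r_def poly_legendre_1)
  qed
  moreover have "kernel_poly n = S (Suc n)"
    by (simp add: kernel_poly_def S_def \<kappa>_def atLeast0AtMost lessThan_Suc_atMost)
  ultimately show ?thesis
    using assms by (simp add: coeff_eq_0)
qed

section \<open>The reproducing property\<close>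

text \<open>The powers \<open>(y \<bullet> u) ^ k\<close> with \<open>k > 0\<close> contribute nothing: an odd one by reflection, and an even
  one because averaging it over the circles around \<open>a\<close> produces a multiple of
  \<open>(1 - (y \<bullet> a)\<^sup>2) ^ (k div 2)\<close>, which vanishes at \<open>y = a\<close>.\<close>

lemma sphere_integral_kernel_poly_orthogonal:
  fixes a u v :: "real^3"
  assumes a: "norm a = 1" and u: "norm u = 1" "a \<bullet> u = 0" and v: "norm v = 1" "u \<bullet> v = 0" "a \<bullet> v = 0"
    and frame: "\<And>y. (y \<bullet> a)\<^sup>2 + (y \<bullet> u)\<^sup>2 + (y \<bullet> v)\<^sup>2 = y \<bullet> y"
    and "k > 0" "degree q + k \<le> n"
  shows "sphere_integral (\<lambda>y. (y \<bullet> u) ^ k * poly (q * kernel_poly n) (y \<bullet> a)) = 0"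
proof (cases "even k")
  case False
  let ?f = "\<lambda>u y. (y \<bullet> u) ^ k * poly (q * kernel_poly n) (y \<bullet> a)"
  have "sphere_integral (?f (-u)) = sphere_integral (?f u)"
    using u by (intro sphere_integral_inner_invariant
        [of u "-u" a "\<lambda>s t. s ^ k * poly (q * kernel_poly n) t"]) (auto intro!: continuous_intros)
  moreover have "sphere_integral (?f (-u)) = - sphere_integral (?f u)"
    using False sphere_integral_cmult[of "-1" "?f u"] by simp
  ultimately show ?thesis by simp
next
  case True
  define J where "J k p = sphere_integral (\<lambda>y. (y \<bullet> u) ^ k * poly p (y \<bullet> a))" for k p
  define W :: "real poly" where "W = [:1, 0, -1:]"
  \<comment> \<open>On the sphere \<open>W\<close> evaluated at \<open>y \<bullet> a\<close> is
    \<open>(y \<bullet> u)\<^sup>2 + (y \<bullet> v)\<^sup>2\<close>, so two powers of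
    \<open>y \<bullet> u\<close> are traded for one factor \<open>W\<close>.\<close>
  have step: "(2 * real j + 2) * J (2*j+2) p = (2 * real j + 1) * J (2*j) (W * p)" for j p
  proof -
    let ?I = "sphere_integral (\<lambda>y. (y \<bullet> u) ^ (2*j) * (y \<bullet> v)\<^sup>2 * poly p (y \<bullet> a))"
    have "J (2*j) (W * p) = sphere_integral (\<lambda>y. (y \<bullet> u) ^ (2*j+2) * poly p (y \<bullet> a)
        + (y \<bullet> u) ^ (2*j) * (y \<bullet> v)\<^sup>2 * poly p (y \<bullet> a))"
      unfolding J_def
    proof (rule sphere_integral_cong)
      fix y :: "real^3" assume "y \<in> S2"
      then have "poly W (y \<bullet> a) = (y \<bullet> u)\<^sup>2 + (y \<bullet> v)\<^sup>2"
        using frame[of y] by (simp add: W_def dot_square_norm power2_eq_square)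
      then show "(y \<bullet> u) ^ (2*j) * poly (W * p) (y \<bullet> a) = (y \<bullet> u) ^ (2*j+2) * poly p (y \<bullet> a)
        + (y \<bullet> u) ^ (2*j) * (y \<bullet> v)\<^sup>2 * poly p (y \<bullet> a)"
        by (simp add: algebra_simps power_add power2_eq_square)
    qed
    also have "\<dots> = J (2*j+2) p + ?I"
      unfolding J_def by (rule sphere_integral_add) (auto intro!: continuous_intros)
    finally have "(2 * real j + 1) * J (2*j) (W * p) = (2 * real j + 1) * J (2*j+2) p + (2 * real j + 1) * ?I"
      by (simp only: distrib_left)
    moreover have "(2 * real j + 1) * ?I = J (2*j+2) p"
      unfolding J_def using u v a
      by (intro sphere_integral_even_power) (auto intro!: continuous_intros)
    ultimately show ?thesis
      by (simp add: algebra_simps)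
  qed
  \<comment> \<open>The explicit factor \<open>W\<close> gives 0 in the base case, since
    \<open>W\<close> vanishes at 1. Each descent in \<open>j\<close> moves one more \<open>W\<close>
    into \<open>r\<close>, raising its degree by at most 2 and lowering \<open>2*j\<close> by 2, so
    the bound persists.\<close>
  have vanish: "J (2*j) (W * r * kernel_poly n) = 0" if "degree r + 2*j + 2 \<le> n" for j r
    using that
  proof (induction j arbitrary: r)
    case 0
    have "degree (W * r) \<le> n"
      using degree_mult_le[of W r] 0 by (simp add: W_def)
    then have "zonal_integral a (W * r * kernel_poly n) = poly (W * r) 1"
      by (rule zonal_integral_kernel_poly[OF a])
    then show ?case
      by (simp add: J_def zonal_integral_def W_def)
  next
    case (Suc j)
    have "degree (W * r) + 2*j + 2 \<le> n"
      using degree_mult_le[of W r] Suc.prems by (simp add: W_def)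
    then have "J (2*j) (W * (W * r * kernel_poly n)) = 0"
      using Suc.IH[of "W * r"] by (simp add: mult.assoc)
    then show ?case
      using step[of j "W * r * kernel_poly n"] by (simp add: add_eq_0_iff)
  qed
  obtain j where j: "k = 2*j+2"
    using True \<open>k > 0\<close> by (metis Suc_eq_plus1 add_2_eq_Suc' dvdE gr0_conv_Suc mult_Suc_right nat_0_less_mult_iff add.commute)
  have "J (2*j) (W * (q * kernel_poly n)) = 0"
    using vanish[of q j] assms by (simp add: j mult.assoc)
  then show ?thesis
    using step[of j "q * kernel_poly n"] by (simp add: J_def j add_eq_0_iff)
qed

lemma continuous_on_G_kernel [continuous_intros]: "continuous_on S (\<lambda>y. G_kernel n y a)"
  unfolding G_kernel_eq_kernel_poly by (intro continuous_intros)

text \<open>Turn \<open>b\<close> around \<open>a\<close> into the plane of \<open>a\<close> and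
  \<open>u\<close> and expand the powers of \<open>y \<bullet> b'\<close> binomially. Only the term
  without \<open>y \<bullet> u\<close> survives, and there the zonal case yields
  \<open>s ^ i\<close>.\<close>

lemma sphere_integral_poly_kernel:
  fixes a b :: "real^3"
  assumes a: "norm a = 1" and b: "norm b = 1" and r: "degree r \<le> n"
  shows "sphere_integral (\<lambda>y. poly r (y \<bullet> b) * G_kernel n y a) = poly r (a \<bullet> b)"
proof -
  obtain u v where u: "norm u = 1" "a \<bullet> u = 0" and v: "norm v = 1" "u \<bullet> v = 0" "a \<bullet> v = 0"
    and frame: "\<And>y. (y \<bullet> a)\<^sup>2 + (y \<bullet> u)\<^sup>2 + (y \<bullet> v)\<^sup>2 = y \<bullet> y"
    using orthonormal_frame[OF a] by metis
  define s where "s = a \<bullet> b"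
  define \<tau> where "\<tau> = sqrt (1 - s\<^sup>2)"
  \<comment> \<open>The coefficient \<open>\<tau>\<close> gives \<open>b'\<close> unit length; its
    inner product with \<open>a\<close> is that of \<open>b\<close>.\<close>
  define b' where "b' = s *\<^sub>R a + \<tau> *\<^sub>R u"
  have aa: "a \<bullet> a = 1" and uu: "u \<bullet> u = 1"
    using a u by (simp_all add: norm_eq_1)
  have "\<bar>s\<bar> \<le> 1"
    using Cauchy_Schwarz_ineq2[of a b] a b by (simp add: s_def)
  then have "s\<^sup>2 + \<tau>\<^sup>2 = 1"
    by (simp add: \<tau>_def abs_square_le_1)
  then have "norm b' = 1"
    by (simp add: norm_eq_1 b'_def inner_add_left inner_add_right aa uu u inner_commute[of u a] power2_eq_square)
  then have b': "norm b' = norm b" "a \<bullet> b' = a \<bullet> b"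
    using b by (simp_all add: b'_def inner_add_right aa u s_def)
  have mono: "sphere_integral (\<lambda>y. (y \<bullet> b) ^ i * G_kernel n y a) = s ^ i" if "i \<le> n" for i
  proof -
    have "sphere_integral (\<lambda>y. (y \<bullet> b) ^ i * G_kernel n y a)
        = sphere_integral (\<lambda>y. (y \<bullet> b') ^ i * G_kernel n y a)"
      unfolding G_kernel_eq_kernel_poly
      by (rule sphere_integral_inner_invariant[OF b', of "\<lambda>s t. s ^ i * poly (kernel_poly n) t"])
         (auto intro!: continuous_intros)
    also have "\<dots> = sphere_integral (\<lambda>y. \<Sum>m\<le>i. (real (i choose m) * \<tau> ^ m * s ^ (i - m)) *
        ((y \<bullet> u) ^ m * poly (monom 1 (i - m) * kernel_poly n) (y \<bullet> a)))"
    proof (rule sphere_integral_cong)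
      fix y :: "real^3"
      have "y \<bullet> b' = \<tau> * (y \<bullet> u) + s * (y \<bullet> a)"
        by (simp add: b'_def inner_add_right)
      then show "(y \<bullet> b') ^ i * G_kernel n y a
        = (\<Sum>m\<le>i. (real (i choose m) * \<tau> ^ m * s ^ (i - m)) *
            ((y \<bullet> u) ^ m * poly (monom 1 (i - m) * kernel_poly n) (y \<bullet> a)))"
        by (simp add: binomial_ring sum_distrib_left sum_distrib_right power_mult_distrib mult_ac
            G_kernel_eq_kernel_poly poly_monom)
    qed
    also have "\<dots> = (\<Sum>m\<le>i. (real (i choose m) * \<tau> ^ m * s ^ (i - m)) *
        sphere_integral (\<lambda>y. (y \<bullet> u) ^ m * poly (monom 1 (i - m) * kernel_poly n) (y \<bullet> a)))"
      by (subst sphere_integral_sum) (auto intro!: continuous_intros simp: sphere_integral_cmult)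
    also have "\<dots> = (\<Sum>m\<le>i. if m = 0 then s ^ i else 0)"
    proof (rule sum.cong)
      fix m assume m: "m \<in> {..i}"
      show "(real (i choose m) * \<tau> ^ m * s ^ (i - m)) *
          sphere_integral (\<lambda>y. (y \<bullet> u) ^ m * poly (monom 1 (i - m) * kernel_poly n) (y \<bullet> a))
        = (if m = 0 then s ^ i else 0)"
      proof (cases "m = 0")
        case True
        have "zonal_integral a (monom 1 i * kernel_poly n) = 1"
          using zonal_integral_kernel_poly[OF a, of "monom 1 i" n] \<open>i \<le> n\<close>
          by (simp add: degree_monom_eq poly_monom)
        then show ?thesis
          by (simp add: True zonal_integral_def)
      next
        case False
        then show ?thesis
          using sphere_integral_kernel_poly_orthogonal[OF a u v frame, of m "monom 1 (i - m)" n] m \<open>i \<le> n\<close>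
          by (simp add: degree_monom_eq)
      qed
    qed simp
    finally show ?thesis by simp
  qed
  have "sphere_integral (\<lambda>y. poly r (y \<bullet> b) * G_kernel n y a)
      = sphere_integral (\<lambda>y. \<Sum>i\<le>degree r. coeff r i * ((y \<bullet> b) ^ i * G_kernel n y a))"
    by (simp add: poly_altdef sum_distrib_right mult.assoc)
  also have "\<dots> = (\<Sum>i\<le>degree r. coeff r i * s ^ i)"
    using r by (subst sphere_integral_sum)
      (auto intro!: continuous_intros sum.cong simp: sphere_integral_cmult mono)
  finally show ?thesis
    by (simp add: poly_altdef s_def)
qed

section \<open>Spherical polynomials\<close>

lemma spherical_polys_add:
  assumes "p \<in> spherical_polys n" "q \<in> spherical_polys n"
  shows "(\<lambda>y. p y + q y) \<in> spherical_polys n"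
proof -
  obtain a b where "\<forall>y\<in>S2. p y = (\<Sum>\<alpha>\<in>multi_indices n. a \<alpha> * (\<Prod>i\<in>UNIV. (y $ i) ^ \<alpha> i))"
    "\<forall>y\<in>S2. q y = (\<Sum>\<alpha>\<in>multi_indices n. b \<alpha> * (\<Prod>i\<in>UNIV. (y $ i) ^ \<alpha> i))"
    using assms unfolding spherical_polys_def by blast
  then show ?thesis
    unfolding spherical_polys_def
    by (auto simp: distrib_right sum.distrib intro!: exI[of _ "\<lambda>\<alpha>. a \<alpha> + b \<alpha>"])
qed

lemma spherical_polys_cmult:
  assumes "p \<in> spherical_polys n"
  shows "(\<lambda>y. k * p y) \<in> spherical_polys n"
proof -
  obtain a where "\<forall>y\<in>S2. p y = (\<Sum>\<alpha>\<in>multi_indices n. a \<alpha> * (\<Prod>i\<in>UNIV. (y $ i) ^ \<alpha> i))"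
    using assms unfolding spherical_polys_def by blast
  then show ?thesis
    unfolding spherical_polys_def
    by (auto simp: sum_distrib_left mult.assoc intro!: exI[of _ "\<lambda>\<alpha>. k * a \<alpha>"])
qed

lemma spherical_polys_monomial:
  assumes "\<alpha> \<in> multi_indices n"
  shows "(\<lambda>y. \<Prod>i\<in>UNIV. (y $ i) ^ \<alpha> i) \<in> spherical_polys n"
  unfolding spherical_polys_def using assms
  by (auto simp: finite_multi_indices if_distrib [of "\<lambda>x. x * _"] cong: if_cong
      intro!: exI[of _ "\<lambda>\<beta>. if \<beta> = \<alpha> then 1 else 0"])

lemma spherical_polys_const: "(\<lambda>_. k) \<in> spherical_polys n"
  using spherical_polys_cmult[OF spherical_polys_monomial[of "\<lambda>_. 0" n], of k]
  by (simp add: multi_indices_def)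

lemma spherical_polys_sum:
  "(\<And>i. i \<in> I \<Longrightarrow> p i \<in> spherical_polys n) \<Longrightarrow> (\<lambda>y. \<Sum>i\<in>I. p i y) \<in> spherical_polys n"
  by (induction I rule: infinite_finite_induct)
     (auto intro!: spherical_polys_add spherical_polys_const)

lemma spherical_polys_cong:
  "p \<in> spherical_polys n \<Longrightarrow> (\<And>y. y \<in> S2 \<Longrightarrow> q y = p y) \<Longrightarrow> q \<in> spherical_polys n"
  unfolding spherical_polys_def by auto

text \<open>Raising one exponent turns monomials into monomials of degree one higher. The product is
  rebuilt as a combination of these, which avoids reindexing the coefficients.\<close>

lemma spherical_polys_mult_component:
  fixes k :: 3
  assumes "p \<in> spherical_polys n"
  shows "(\<lambda>y. (y $ k) * p y) \<in> spherical_polys (Suc n)"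
proof -
  obtain a where a: "\<And>y. y \<in> S2 \<Longrightarrow> p y = (\<Sum>\<alpha>\<in>multi_indices n. a \<alpha> * (\<Prod>i\<in>UNIV. (y $ i) ^ \<alpha> i))"
    using assms unfolding spherical_polys_def by blast
  define up where "up \<alpha> = \<alpha>(k := Suc (\<alpha> k))" for \<alpha> :: "3 \<Rightarrow> nat"
  have up: "up \<alpha> \<in> multi_indices (Suc n)" if "\<alpha> \<in> multi_indices n" for \<alpha>
    using that exhaust_3[of k] by (auto simp: multi_indices_def up_def sum_3)
  have prod: "(\<Prod>i\<in>UNIV. (y $ i) ^ up \<alpha> i) = (y $ k) * (\<Prod>i\<in>UNIV. (y $ i) ^ \<alpha> i)"
    for y :: "real^3" and \<alpha>
  proof -
    have "(\<Prod>i\<in>UNIV. (y $ i) ^ up \<alpha> i) = (\<Prod>i\<in>UNIV. (if i = k then y $ k else 1) * (y $ i) ^ \<alpha> i)"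
      by (rule prod.cong) (auto simp: up_def)
    then show ?thesis
      by (simp add: prod.distrib)
  qed
  have "(\<lambda>y. \<Sum>\<alpha>\<in>multi_indices n. a \<alpha> * (\<Prod>i\<in>UNIV. (y $ i) ^ up \<alpha> i)) \<in> spherical_polys (Suc n)"
    by (intro spherical_polys_sum spherical_polys_cmult spherical_polys_monomial up)
  then show ?thesis
    by (rule spherical_polys_cong) (simp add: a prod sum_distrib_left mult_ac)
qed

lemma spherical_polys_mono:
  assumes "p \<in> spherical_polys m" "m \<le> n"
  shows "p \<in> spherical_polys n"
proof -
  obtain a where a: "\<And>y. y \<in> S2 \<Longrightarrow> p y = (\<Sum>\<alpha>\<in>multi_indices m. a \<alpha> * (\<Prod>i\<in>UNIV. (y $ i) ^ \<alpha> i))"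
    using assms unfolding spherical_polys_def by blast
  have "(\<lambda>y. \<Sum>\<alpha>\<in>multi_indices m. a \<alpha> * (\<Prod>i\<in>UNIV. (y $ i) ^ \<alpha> i)) \<in> spherical_polys n"
    using assms by (intro spherical_polys_sum spherical_polys_cmult spherical_polys_monomial)
       (auto simp: multi_indices_def)
  then show ?thesis
    by (rule spherical_polys_cong) (rule a)
qed

lemma spherical_polys_poly_inner:
  fixes b :: "real^3"
  assumes "degree r \<le> n"
  shows "(\<lambda>y. poly r (y \<bullet> b)) \<in> spherical_polys n"
proof -
  have "(\<lambda>y. (y \<bullet> b) ^ i) \<in> spherical_polys i" for i
  proof (induction i)
    case (Suc i)
    have "(\<lambda>y. \<Sum>k\<in>UNIV. b $ k * (y $ k * (y \<bullet> b) ^ i)) \<in> spherical_polys (Suc i)"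
      by (intro spherical_polys_sum spherical_polys_cmult spherical_polys_mult_component Suc)
    then show ?case
      by (rule spherical_polys_cong) (simp add: inner_vec_def[of _ b] sum_distrib_right mult_ac)
  qed (simp add: spherical_polys_const)
  then have "(\<lambda>y. (y \<bullet> b) ^ i) \<in> spherical_polys n" if "i \<le> degree r" for i
    using that assms by (blast intro: spherical_polys_mono order_trans)
  then show ?thesis
    unfolding poly_altdef by (intro spherical_polys_sum spherical_polys_cmult) auto
qed

lemma continuous_on_spherical_polys:
  assumes "p \<in> spherical_polys n"
  shows "continuous_on S2 p"
proof -
  obtain a where a: "\<And>y. y \<in> S2 \<Longrightarrow> p y = (\<Sum>\<alpha>\<in>multi_indices n. a \<alpha> * (\<Prod>i\<in>UNIV. (y $ i) ^ \<alpha> i))"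
    using assms unfolding spherical_polys_def by blast
  have "continuous_on S2 (\<lambda>y::real^3. \<Sum>\<alpha>\<in>multi_indices n. a \<alpha> * (\<Prod>i\<in>UNIV. (y $ i) ^ \<alpha> i))"
    by (intro continuous_intros)
  then show ?thesis
    by (subst continuous_on_cong[OF refl a])
qed

section \<open>The norms\<close>

lemma L2_norm_S2_squared: "(L2_norm_S2 f)\<^sup>2 = sphere_integral (\<lambda>y. (f y)\<^sup>2)"
  by (simp add: L2_norm_S2_def sphere_integral_nonneg)

lemma L2_norm_S2_nonneg: "0 \<le> L2_norm_S2 f"
  by (simp add: L2_norm_S2_def sphere_integral_nonneg)

text \<open>Comparing absolute values also covers a change of sign.\<close>

lemma L2_norm_S2_cong: "(\<And>y. y \<in> S2 \<Longrightarrow> \<bar>f y\<bar> = \<bar>g y\<bar>) \<Longrightarrow> L2_norm_S2 f = L2_norm_S2 g"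
  unfolding L2_norm_S2_def by (metis (no_types, lifting) sphere_integral_cong power2_abs)

text \<open>The integral of \<open>(f / A - g / B)\<^sup>2\<close> is nonnegative for all \<open>A > \<parallel>f\<parallel>\<close> and \<open>B > \<parallel>g\<parallel>\<close>; strictness
  avoids a division by zero.\<close>

lemma sphere_integral_mult_le:
  assumes f: "continuous_on S2 f" and g: "continuous_on S2 g"
  shows "sphere_integral (\<lambda>y. f y * g y) \<le> L2_norm_S2 f * L2_norm_S2 g"
proof -
  have *: "sphere_integral (\<lambda>y. f y * g y) \<le> A * B"
    if A: "A > L2_norm_S2 f" and B: "B > L2_norm_S2 g" for A B
  proof -
    have pos: "A > 0" "B > 0"
      using A B L2_norm_S2_nonneg[of f] L2_norm_S2_nonneg[of g] by auto
    have "sphere_integral (\<lambda>y. (1 / (A * B)) * (f y * g y))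
        \<le> sphere_integral (\<lambda>y. (1 / (2 * A\<^sup>2)) * (f y)\<^sup>2 + (1 / (2 * B\<^sup>2)) * (g y)\<^sup>2)"
    proof (rule sphere_integral_mono)
      fix y
      have "0 \<le> (f y / A - g y / B)\<^sup>2" by simp
      also have "\<dots> = 2 * ((1 / (2 * A\<^sup>2)) * (f y)\<^sup>2 + (1 / (2 * B\<^sup>2)) * (g y)\<^sup>2 - (1 / (A * B)) * (f y * g y))"
        using pos by (simp add: power2_diff power_divide algebra_simps)
      finally show "(1 / (A * B)) * (f y * g y) \<le> (1 / (2 * A\<^sup>2)) * (f y)\<^sup>2 + (1 / (2 * B\<^sup>2)) * (g y)\<^sup>2"
        by simp
    qed (intro continuous_intros f g)+
    also have "\<dots> = sphere_integral (\<lambda>y. (1 / (2 * A\<^sup>2)) * (f y)\<^sup>2)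
        + sphere_integral (\<lambda>y. (1 / (2 * B\<^sup>2)) * (g y)\<^sup>2)"
      by (rule sphere_integral_add) (intro continuous_intros f g)+
    also have "\<dots> = (1 / (2 * A\<^sup>2)) * (L2_norm_S2 f)\<^sup>2 + (1 / (2 * B\<^sup>2)) * (L2_norm_S2 g)\<^sup>2"
      by (simp only: sphere_integral_cmult L2_norm_S2_squared)
    also have "\<dots> \<le> (1 / (2 * A\<^sup>2)) * A\<^sup>2 + (1 / (2 * B\<^sup>2)) * B\<^sup>2"
      using A B pos by (intro add_mono mult_left_mono power_mono L2_norm_S2_nonneg) auto
    also have "\<dots> = 1"
      using pos by simp
    finally have "(1 / (A * B)) * sphere_integral (\<lambda>y. f y * g y) \<le> 1"
      by (simp only: sphere_integral_cmult)
    then show ?thesis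
      using pos by (simp add: field_simps)
  qed
  \<comment> \<open>Let \<open>A\<close> and \<open>B\<close> decrease to the norms.\<close>
  have "((\<lambda>e. (L2_norm_S2 f + e) * (L2_norm_S2 g + e)) \<longlongrightarrow> (L2_norm_S2 f + 0) * (L2_norm_S2 g + 0)) (at_right 0)"
    by (intro tendsto_intros)
  moreover have "eventually (\<lambda>e. sphere_integral (\<lambda>y. f y * g y) \<le> (L2_norm_S2 f + e) * (L2_norm_S2 g + e)) (at_right 0)"
    using eventually_at_right_less[of "0::real"] by eventually_elim (rule *; simp)
  ultimately show ?thesis
    using tendsto_lowerbound[of _ _ "at_right (0::real)"] by fastforce
qed

lemma L2_norm_S2_triangle:
  assumes f: "continuous_on S2 f" and g: "continuous_on S2 g"
  shows "L2_norm_S2 (\<lambda>y. f y + g y) \<le> L2_norm_S2 f + L2_norm_S2 g"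
proof (rule power2_le_imp_le)
  have "(L2_norm_S2 (\<lambda>y. f y + g y))\<^sup>2
      = sphere_integral (\<lambda>y. ((f y)\<^sup>2 + (g y)\<^sup>2) + 2 * (f y * g y))"
    by (simp add: L2_norm_S2_squared power2_sum mult.assoc)
  also have "\<dots> = (L2_norm_S2 f)\<^sup>2 + (L2_norm_S2 g)\<^sup>2 + 2 * sphere_integral (\<lambda>y. f y * g y)"
    by (subst sphere_integral_add; (subst sphere_integral_add)?;
        (intro continuous_intros f g)?; simp add: L2_norm_S2_squared sphere_integral_cmult)
  also have "\<dots> \<le> (L2_norm_S2 f + L2_norm_S2 g)\<^sup>2"
    using sphere_integral_mult_le[OF f g] by (simp add: power2_sum)
  finally show "(L2_norm_S2 (\<lambda>y. f y + g y))\<^sup>2 \<le> (L2_norm_S2 f + L2_norm_S2 g)\<^sup>2" .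
qed (simp add: L2_norm_S2_nonneg)

section \<open>Comparison with the supremum norm\<close>

lemma abs_le_sup_norm_S2:
  assumes "continuous_on S2 f" "y \<in> S2"
  shows "\<bar>f y\<bar> \<le> sup_norm_S2 f"
proof -
  have "compact ((\<lambda>y. \<bar>f y\<bar>) ` S2)"
    using assms by (intro compact_continuous_image continuous_intros) auto
  then show ?thesis
    unfolding sup_norm_S2_def using assms
    by (intro cSUP_upper bounded_imp_bdd_above compact_imp_bounded)
qed

lemma L2_norm_S2_le_sup_norm:
  assumes f: "continuous_on S2 f"
  shows "L2_norm_S2 f \<le> sqrt (4 * pi) * sup_norm_S2 f"
proof -
  obtain y0 :: "real^3" where "y0 \<in> S2"
    using vector_choose_size[of 1] by auto
  then have pos: "0 \<le> sup_norm_S2 f"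
    using abs_le_sup_norm_S2[OF f] by force
  have "sphere_integral (\<lambda>y. (f y)\<^sup>2) \<le> sphere_integral (\<lambda>_. (sup_norm_S2 f)\<^sup>2)"
    using abs_le_sup_norm_S2[OF f] by (intro sphere_integral_mono continuous_intros f)
      (metis abs_ge_zero power2_abs power_mono)
  then have "L2_norm_S2 f \<le> sqrt (4 * pi * (sup_norm_S2 f)\<^sup>2)"
    unfolding L2_norm_S2_def by (simp add: sphere_integral_const)
  then show ?thesis
    using pos by (simp add: real_sqrt_mult)
qed

section \<open>Stability of hyperinterpolation\<close>

lemma hyperinterpolation_in_spherical_polys: "hyperinterpolation x w n f \<in> spherical_polys n"
  unfolding hyperinterpolation_def [abs_def] G_kernel_eq_kernel_poly
  by (intro spherical_polys_sum spherical_polys_cmult spherical_polys_poly_inner degree_kernel_poly)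

lemma hyperinterpolation_diff:
  "hyperinterpolation x w n (\<lambda>y. f y - g y) y = hyperinterpolation x w n f y - hyperinterpolation x w n g y"
  by (simp add: hyperinterpolation_def algebra_simps sum_subtractf)

text \<open>\<open>L\<^sub>n f\<close> is a combination of functions zonal around the nodes, so the
  reproducing identity for zonal polynomials applies with \<open>r\<close> the kernel polynomial and
  \<open>b = x j\<close>.\<close>

lemma sphere_integral_hyperinterpolation_kernel:
  assumes x: "\<forall>j. x j \<in> S2" and a: "a \<in> S2"
  shows "sphere_integral (\<lambda>y. hyperinterpolation x w n f y * G_kernel n y a) = hyperinterpolation x w n f a"
proof -
  have rep: "sphere_integral (\<lambda>y. G_kernel n y (x j) * G_kernel n y a) = G_kernel n a (x j)" for j
    using sphere_integral_poly_kernel[of a "x j" "kernel_poly n" n] x a degree_kernel_poly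
    by (simp add: G_kernel_eq_kernel_poly)
  have "sphere_integral (\<lambda>y. hyperinterpolation x w n f y * G_kernel n y a)
      = sphere_integral (\<lambda>y. \<Sum>j\<in>UNIV. (w $ j * f (x j)) * (G_kernel n y (x j) * G_kernel n y a))"
    by (simp add: hyperinterpolation_def sum_distrib_right mult.assoc)
  also have "\<dots> = (\<Sum>j\<in>UNIV. (w $ j * f (x j)) * sphere_integral (\<lambda>y. G_kernel n y (x j) * G_kernel n y a))"
    unfolding G_kernel_eq_kernel_poly
    by (subst sphere_integral_sum) (auto intro!: continuous_intros simp: sphere_integral_cmult)
  finally show ?thesis
    by (simp add: rep hyperinterpolation_def)
qed

lemma hyperinterpolation_stable:
  assumes x: "\<forall>j. x j \<in> S2" and c: "c \<ge> 0" and MZ: "L2_MZ x w n c" and f: "continuous_on S2 f"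
  shows "L2_norm_S2 (hyperinterpolation x w n f) \<le> c * sqrt (4 * pi) * sup_norm_S2 f"
proof -
  define L where "L = hyperinterpolation x w n f"
  define E where "E = L2_norm_S2 L"
  define F where "F = sup_norm_S2 f"
  have L: "L \<in> spherical_polys n"
    unfolding L_def by (rule hyperinterpolation_in_spherical_polys)
  have F: "\<bar>f (x j)\<bar> \<le> F" for j
    unfolding F_def using f x by (intro abs_le_sup_norm_S2) auto
  then have "F \<ge> 0"
    by (meson abs_ge_zero order_trans)
  \<comment> \<open>The MZ condition for the constant 1, whose square integrates to
    \<open>4\<pi>\<close>.\<close>
  have W: "(\<Sum>j\<in>UNIV. \<bar>w $ j\<bar>) \<le> c * (4 * pi)"
    using MZ spherical_polys_const[of 1 n]
    by (auto simp: L2_MZ_def quadrature_def abs_weights_def sphere_integral_const dest!: bspec)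
  have WL: "(\<Sum>j\<in>UNIV. \<bar>w $ j\<bar> * (L (x j))\<^sup>2) \<le> c * E\<^sup>2"
    using MZ L by (auto simp: L2_MZ_def quadrature_def abs_weights_def L2_norm_S2_squared E_def)
  \<comment> \<open>Only one factor of \<open>L\<^sup>2\<close> is expanded; the other is then
    reproduced at the nodes.\<close>
  have "E\<^sup>2 = sphere_integral (\<lambda>y. \<Sum>j\<in>UNIV. (w $ j * f (x j)) * (L y * G_kernel n y (x j)))"
    unfolding E_def L2_norm_S2_squared
    by (rule sphere_integral_cong)
       (simp add: L_def hyperinterpolation_def power2_eq_square sum_distrib_left mult_ac)
  also have "\<dots> = (\<Sum>j\<in>UNIV. (w $ j * f (x j)) * sphere_integral (\<lambda>y. L y * G_kernel n y (x j)))"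
    unfolding G_kernel_eq_kernel_poly
    by (subst sphere_integral_sum)
       (auto intro!: continuous_intros continuous_on_spherical_polys[OF L] simp: sphere_integral_cmult)
  also have "\<dots> = (\<Sum>j\<in>UNIV. (w $ j * f (x j)) * L (x j))"
    using sphere_integral_hyperinterpolation_kernel[OF x] x by (simp add: L_def)
  \<comment> \<open>Splitting each absolute weight into two square roots prepares the weighted
    Cauchy-Schwarz inequality.\<close>
  also have "\<dots> \<le> (\<Sum>j\<in>UNIV. F * (sqrt \<bar>w $ j\<bar> * (sqrt \<bar>w $ j\<bar> * \<bar>L (x j)\<bar>)))"
  proof (rule sum_mono)
    fix j
    have "(w $ j * f (x j)) * L (x j) \<le> \<bar>(w $ j * f (x j)) * L (x j)\<bar>"
      by (rule abs_ge_self)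
    also have "\<dots> = \<bar>f (x j)\<bar> * (\<bar>w $ j\<bar> * \<bar>L (x j)\<bar>)"
      by (simp add: abs_mult)
    also have "\<dots> \<le> F * (\<bar>w $ j\<bar> * \<bar>L (x j)\<bar>)"
      by (intro mult_right_mono F) auto
    also have "\<bar>w $ j\<bar> * \<bar>L (x j)\<bar> = sqrt \<bar>w $ j\<bar> * (sqrt \<bar>w $ j\<bar> * \<bar>L (x j)\<bar>)"
      by (simp flip: mult.assoc)
    finally show "(w $ j * f (x j)) * L (x j) \<le> F * (sqrt \<bar>w $ j\<bar> * (sqrt \<bar>w $ j\<bar> * \<bar>L (x j)\<bar>))" .
  qed
  finally have E1: "E\<^sup>2 \<le> F * (\<Sum>j\<in>UNIV. sqrt \<bar>w $ j\<bar> * (sqrt \<bar>w $ j\<bar> * \<bar>L (x j)\<bar>))"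
    by (simp add: sum_distrib_left)
  have "(\<Sum>j\<in>UNIV. sqrt \<bar>w $ j\<bar> * (sqrt \<bar>w $ j\<bar> * \<bar>L (x j)\<bar>))\<^sup>2
      \<le> (\<Sum>j\<in>UNIV. \<bar>w $ j\<bar>) * (\<Sum>j\<in>UNIV. \<bar>w $ j\<bar> * (L (x j))\<^sup>2)"
    using Cauchy_Schwarz_ineq_sum[of "\<lambda>j. sqrt \<bar>w $ j\<bar>" "\<lambda>j. sqrt \<bar>w $ j\<bar> * \<bar>L (x j)\<bar>" UNIV]
    by (simp add: power_mult_distrib)
  also have "\<dots> \<le> (c * (4 * pi)) * (c * E\<^sup>2)"
    using W WL c by (intro mult_mono sum_nonneg) auto
  also have "\<dots> = (c * sqrt (4 * pi) * E)\<^sup>2"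
    by (simp add: power_mult_distrib power2_eq_square[of c])
  finally have "(\<Sum>j\<in>UNIV. sqrt \<bar>w $ j\<bar> * (sqrt \<bar>w $ j\<bar> * \<bar>L (x j)\<bar>)) \<le> c * sqrt (4 * pi) * E"
    by (rule power2_le_imp_le) (simp add: c E_def L2_norm_S2_nonneg)
  then have "E * E \<le> (c * sqrt (4 * pi) * F) * E"
    using E1 mult_left_mono[OF _ \<open>F \<ge> 0\<close>] by (fastforce simp: power2_eq_square mult_ac)
  \<comment> \<open>Cancel \<open>E\<close> if it is nonzero; otherwise the right-hand side is
    nonnegative.\<close>
  then have "E \<le> c * sqrt (4 * pi) * F"
    using c \<open>F \<ge> 0\<close> L2_norm_S2_nonneg[of L]
    by (cases "E = 0") (auto simp: E_def mult_le_cancel_right)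
  then show ?thesis
    by (simp add: E_def L_def F_def)
qed

theorem theorem5p3:
  fixes x :: "'N::finite \<Rightarrow> real^3" and w :: "real^'N" and n :: nat and c :: real
  assumes "\<forall>j. x j \<in> S2"
    and "c \<ge> 0"
    and "L2_MZ x w n c"
  shows "opnorm_C_L2 (hyperinterpolation x w n) \<le> ereal (c * sqrt (4 * pi)) \<and>
    (\<forall>f\<in>C_S2. \<forall>p. best_uniform_approx n f p \<longrightarrow>
       L2_norm_S2 (\<lambda>y. hyperinterpolation x w n f y - f y)
         \<le> (c + 1) * sqrt (4 * pi) * sup_norm_S2 (\<lambda>y. f y - p y)
            + L2_norm_S2 (\<lambda>y. hyperinterpolation x w n p y - p y))"
proof (intro conjI ballI allI impI)
  show "opnorm_C_L2 (hyperinterpolation x w n) \<le> ereal (c * sqrt (4 * pi))"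
    unfolding opnorm_C_L2_def
  proof (rule SUP_least)
    fix f assume "f \<in> {f \<in> C_S2. sup_norm_S2 f \<le> 1}"
    then have f: "continuous_on S2 f" "sup_norm_S2 f \<le> 1"
      by (auto simp: C_S2_def)
    have "L2_norm_S2 (hyperinterpolation x w n f) \<le> c * sqrt (4 * pi) * sup_norm_S2 f"
      by (rule hyperinterpolation_stable[OF assms f(1)])
    also have "\<dots> \<le> c * sqrt (4 * pi) * 1"
      using f(2) \<open>c \<ge> 0\<close> by (intro mult_left_mono) auto
    finally show "ereal (L2_norm_S2 (hyperinterpolation x w n f)) \<le> ereal (c * sqrt (4 * pi))"
      by simp
  qed
next
  fix f p assume "f \<in> C_S2" and "best_uniform_approx n f p"
  then have f: "continuous_on S2 f" and p: "continuous_on S2 p"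
    by (auto simp: C_S2_def best_uniform_approx_def is_arg_min_def intro: continuous_on_spherical_polys)
  define g where "g = (\<lambda>y. f y - p y)"
  define L where "L = hyperinterpolation x w n"
  have g: "continuous_on S2 g"
    unfolding g_def by (intro continuous_intros f p)
  have L: "continuous_on S2 (L h)" for h
    unfolding L_def by (rule continuous_on_spherical_polys[OF hyperinterpolation_in_spherical_polys])
  have "L2_norm_S2 (\<lambda>y. L f y - f y) = L2_norm_S2 (\<lambda>y. (L g y + (L p y - p y)) + (- g y))"
    by (rule L2_norm_S2_cong) (simp add: L_def g_def hyperinterpolation_diff)
  also have "\<dots> \<le> L2_norm_S2 (\<lambda>y. L g y + (L p y - p y)) + L2_norm_S2 (\<lambda>y. - g y)"
    by (intro L2_norm_S2_triangle continuous_intros L g p)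
  also have "L2_norm_S2 (\<lambda>y. L g y + (L p y - p y)) \<le> L2_norm_S2 (L g) + L2_norm_S2 (\<lambda>y. L p y - p y)"
    by (intro L2_norm_S2_triangle continuous_intros L p)
  \<comment> \<open>Stability applied to \<open>g\<close> gives the share \<open>c\<close> of the
    factor \<open>c + 1\<close>; the norm of \<open>g\<close> itself gives the share 1.\<close>
  also have "L2_norm_S2 (L g) \<le> c * sqrt (4 * pi) * sup_norm_S2 g"
    unfolding L_def by (rule hyperinterpolation_stable[OF assms g])
  also have "L2_norm_S2 (\<lambda>y. - g y) = L2_norm_S2 g"
    by (rule L2_norm_S2_cong) simp
  also have "L2_norm_S2 g \<le> sqrt (4 * pi) * sup_norm_S2 g"
    by (rule L2_norm_S2_le_sup_norm[OF g])
  finally show "L2_norm_S2 (\<lambda>y. hyperinterpolation x w n f y - f y)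
         \<le> (c + 1) * sqrt (4 * pi) * sup_norm_S2 (\<lambda>y. f y - p y)
            + L2_norm_S2 (\<lambda>y. hyperinterpolation x w n p y - p y)"
    by (simp add: L_def g_def algebra_simps)
qed

end
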